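(* Let $C$ be a torsion-free finite associative conformal algebra over a field $\Bbbk$ of characteristic zero, and let $H=\Bbbk[D]$. Then $C$ has a faithful (left conformal) representation on a free finitely generated $H$-module.
   Context: $\Bbbk$ is a field of characteristic $0$ and $H=\Bbbk[D]$ is the polynomial algebra. A conformal algebra is a left unital $H$-module $C$ with $\Bbbk$-bilinear products $a_{(n)}b$, $n\in\mathbb Z_{\ge 0}$, such that for all $a,b\in C$: $a_{(n)}b=0$ for almost all $n$; $(Da)_{(n)}b=-n\,a_{(n-1)}b$; $a_{(n)}(Db)=D(a_{(n)}b)+n\,a_{(n-1)}b$ (products with negative index are zero). It is associative if $a_{(n)}(b_{(m)}c)=\sum_{s\ge0}\binom ns (a_{(n-s)}b)_{(m+s)}c$ for all $a,b,c\in C$, $n,m\ge0$. It is finite if it is finitely generated as an $H$-module, and torsion-free if it has no torsion as an $H$-module. A (left conformal) representation of an associative conformal algebra $C$ on an $H$-module $M$ is given by $\Bbbk$-bilinear maps $C\times M\to M$, $(a,v)\mapsto a_{(n)}v$, $n\ge 0$, such that for all $a,b\in C$, $v\in M$, $n,m\ge 0$: $a_{(n)}v=0$ for almost all $n$; $(Da)_{(n)}v=-n\,a_{(n-1)}v$; $a_{(n)}(Dv)=D(a_{(n)}v)+n\,a_{(n-1)}v$; $a_{(n)}(b_{(m)}v)=\sum_{s\ge0}\binom ns (a_{(n-s)}b)_{(m+s)}v$. It is faithful if $a_{(n)}v=0$ for all $n\ge0$ and all $v\in M$ implies $a=0$. *)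

theory Defs
  imports "HOL-Computational_Algebra.Polynomial"
begin

text \<open>
  The ring \<open>H = k[D]\<close> is \<^typ>\<open>'k poly\<close> and unital \<open>H\<close>-modules are instances of the library locale
  \<^locale>\<open>module\<close>. The field \<open>k\<close> sits in \<open>H\<close> as the constant polynomials \<open>[:x:]\<close>, so this locale
  also carries the induced \<open>k\<close>-vector space structure.
\<close>

locale H_module = module scale
  for scale :: "'k::field_char_0 poly \<Rightarrow> 'm::ab_group_add \<Rightarrow> 'm"
begin

definition D :: "'m \<Rightarrow> 'm" where
  "D v = scale [:0, 1:] v"

definition kscale :: "'k \<Rightarrow> 'm \<Rightarrow> 'm" where
  "kscale x v = scale [:x:] v"

definition finitely_generated :: "'m set \<Rightarrow> bool" where
  "finitely_generated V \<longleftrightarrow> (\<exists>S. finite S \<and> span S = V)"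

definition free_finitely_generated :: "'m set \<Rightarrow> bool" where
  "free_finitely_generated V \<longleftrightarrow> (\<exists>B. finite B \<and> independent B \<and> span B = V)"

definition torsion_free :: "'m set \<Rightarrow> bool" where
  "torsion_free V \<longleftrightarrow> (\<forall>p. \<forall>v\<in>V. scale p v = 0 \<longrightarrow> p = 0 \<or> v = 0)"

end

text \<open>
  The value \<open>prod n a b\<close> is the product \<open>a\<^bsub>(n)\<^esub> b\<close>. For \<open>n = 0\<close> the term with index \<open>n - 1\<close>
  has coefficient \<open>0\<close>, in accordance with the convention that products of negative index vanish.
\<close>

locale conformal_algebra = H_module scale
  for scale :: "'k::field_char_0 poly \<Rightarrow> 'c::ab_group_add \<Rightarrow> 'c" +
  fixes prod :: "nat \<Rightarrow> 'c \<Rightarrow> 'c \<Rightarrow> 'c"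
  assumes prod_add_left: "prod n (a + b) c = prod n a c + prod n b c"
    and prod_kscale_left: "prod n (kscale x a) b = kscale x (prod n a b)"
    and prod_add_right: "prod n a (b + c) = prod n a b + prod n a c"
    and prod_kscale_right: "prod n a (kscale x b) = kscale x (prod n a b)"
    and prod_locality: "finite {n. prod n a b \<noteq> 0}"
    and prod_D_left: "prod n (D a) b = kscale (- of_nat n) (prod (n - 1) a b)"
    and prod_D_right: "prod n a (D b) = D (prod n a b) + kscale (of_nat n) (prod (n - 1) a b)"

text \<open>The sum over \<open>s\<close> stops at \<open>n\<close> because \<open>n choose s = 0\<close> for \<open>s > n\<close>.\<close>

locale associative_conformal_algebra = conformal_algebra scale prod
  for scale :: "'k::field_char_0 poly \<Rightarrow> 'c::ab_group_add \<Rightarrow> 'c" and prod +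
  assumes prod_assoc: "prod n a (prod m b c) =
    (\<Sum>s\<le>n. kscale (of_nat (n choose s)) (prod (m + s) (prod (n - s) a b) c))"

text \<open>
  Since HOL has no quantification over types, the module \<open>M\<close> of a representation is a submodule
  \<open>V\<close> of an ambient \<open>H\<close>-module (possibly the whole of it), and \<open>act n a v\<close>, standing for
  \<open>a\<^bsub>(n)\<^esub> v\<close>, matters only for \<open>v \<in> V\<close>. Existence of a representation on a
  free finitely generated \<open>H\<close>-module can then be stated over the single ambient type
  \<^typ>\<open>'k poly poly\<close>: under \<^const>\<open>smult\<close> it is \<open>H[x]\<close>, whose submodules spanned by
  \<open>1, x, \<dots>, x\<^sup>r\<^sup>-\<^sup>1\<close> are free of every finite rank \<open>r\<close>, so each free finitely
  generated \<open>H\<close>-module has an isomorphic copy there.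
\<close>

locale conformal_representation =
  C: associative_conformal_algebra scale prod + M: H_module scaleM
  for scale :: "'k::field_char_0 poly \<Rightarrow> 'c::ab_group_add \<Rightarrow> 'c" and prod
    and scaleM :: "'k poly \<Rightarrow> 'm::ab_group_add \<Rightarrow> 'm" +
  fixes V :: "'m set" and act :: "nat \<Rightarrow> 'c \<Rightarrow> 'm \<Rightarrow> 'm"
  assumes submodule: "M.subspace V"
    and act_closed: "v \<in> V \<Longrightarrow> act n a v \<in> V"
    and act_add_left: "v \<in> V \<Longrightarrow> act n (a + b) v = act n a v + act n b v"
    and act_kscale_left: "v \<in> V \<Longrightarrow> act n (C.kscale x a) v = M.kscale x (act n a v)"
    and act_add_right: "v \<in> V \<Longrightarrow> w \<in> V \<Longrightarrow> act n a (v + w) = act n a v + act n a w"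
    and act_kscale_right: "v \<in> V \<Longrightarrow> act n a (M.kscale x v) = M.kscale x (act n a v)"
    and act_locality: "v \<in> V \<Longrightarrow> finite {n. act n a v \<noteq> 0}"
    and act_D_left: "v \<in> V \<Longrightarrow> act n (C.D a) v = M.kscale (- of_nat n) (act (n - 1) a v)"
    and act_D_right: "v \<in> V \<Longrightarrow>
      act n a (M.D v) = M.D (act n a v) + M.kscale (of_nat n) (act (n - 1) a v)"
    and act_assoc: "v \<in> V \<Longrightarrow> act n a (act m b v) =
      (\<Sum>s\<le>n. M.kscale (of_nat (n choose s)) (act (m + s) (prod (n - s) a b) v))"
begin

definition faithful :: bool where
  "faithful \<longleftrightarrow> (\<forall>a. (\<forall>n. \<forall>v\<in>V. act n a v = 0) \<longrightarrow> a = 0)"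

end

end

theory Submission
  imports Defs "HOL-Library.Function_Algebras"
begin

text \<open>
  By torsion-freeness \<open>C\<close> is free over \<open>H\<close>, say with basis \<open>B\<close>. Its coefficient algebra \<open>A\<^sub>+\<close>, spanned
  by symbols \<open>a(n)\<close> with \<open>(D a)(n) = - n a(n-1)\<close> and product
  \<open>a(n) b(m) = \<Sum>\<^sub>s (n choose s) (a\<^bsub>(n-s)\<^esub> b)(m+s)\<close>, then has the vector space basis \<open>j(m)\<close>,
  \<open>j \<in> B\<close>, \<open>m \<ge> 0\<close>. Adjoin an identity and let \<open>A\<^sub>+\<close> act on linear functionals from the right.
  The coordinate functionals of the \<open>j(0)\<close> generate a finite-dimensional right module \<open>X\<close>: the degrees
  in \<open>D\<close> of all coordinates of the products \<open>a\<^bsub>(n)\<^esub> j\<close> have a common bound \<open>d\<close>, because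
  \<open>(D a)\<^bsub>(n)\<^esub> j\<close> is a scalar multiple of \<open>a\<^bsub>(n-1)\<^esub> j\<close>, so every functional in \<open>X\<close> kills the
  \<open>j(m)\<close> with \<open>m > d\<close>. The dual of \<open>X\<close> is a finite-dimensional left \<open>A\<^sub>+\<close>-module, and
  \<open>H \<otimes> X\<^sup>*\<close> is a representation of \<open>C\<close>. It is faithful because an \<open>a\<close> acting by zero satisfies
  \<open>f(a(n)) = (f \<cdot> a(n))(1) = 0\<close> for all generators \<open>f\<close> of \<open>X\<close>, and these values are, up to nonzero
  factors, the coefficients of \<open>a\<close>.
\<close>

section \<open>Binomial sums\<close>

text \<open>Pascal's rule under the sum; it drives the induction in
  \<open>vandermonde_sum\<close>.\<close>

lemma sum_binomial_Suc:
  fixes h :: "nat \<Rightarrow> 'a::comm_semiring_1"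
  shows "(\<Sum>s\<le>Suc n. of_nat (Suc n choose s) * h s)
    = (\<Sum>s\<le>n. of_nat (n choose s) * h s) + (\<Sum>s\<le>n. of_nat (n choose s) * h (Suc s))"
proof -
  have "(\<Sum>s\<le>Suc n. of_nat (Suc n choose s) * h s)
    = h 0 + (\<Sum>s\<le>n. of_nat (n choose Suc s) * h (Suc s)) + (\<Sum>s\<le>n. of_nat (n choose s) * h (Suc s))"
    by (subst sum.atMost_Suc_shift) (simp add: sum.distrib algebra_simps)
  also have "h 0 + (\<Sum>s\<le>n. of_nat (n choose Suc s) * h (Suc s)) = (\<Sum>s\<le>Suc n. of_nat (n choose s) * h s)"
    by (subst sum.atMost_Suc_shift) simp
  finally show ?thesis by (simp add: binomial_eq_0)
qed

text \<open>With E the shift operator on sequences, both sides are (1 + E)^a (1 + E)^b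
  \<open>G\<close> evaluated at 0.\<close>

lemma vandermonde_sum:
  fixes G :: "nat \<Rightarrow> 'a::comm_semiring_1"
  shows "(\<Sum>s\<le>a. of_nat (a choose s) * (\<Sum>u\<le>b. of_nat (b choose u) * G (s + u)))
    = (\<Sum>w\<le>a + b. of_nat (a + b choose w) * G w)"
proof (induction a arbitrary: G)
  case (Suc a)
  show ?case
    unfolding sum_binomial_Suc add_Suc
    using Suc.IH[of G] Suc.IH[of "\<lambda>w. G (Suc w)"] by (simp del: sum.atMost_Suc)
qed simp

lemma sum_triangle_swap:
  "(\<Sum>s\<le>n::nat. \<Sum>l\<le>n - s. f s l) = (\<Sum>l\<le>n. \<Sum>s\<le>n - l. f s l)"
  unfolding sum.Sigma[OF finite_atMost ballI[OF finite_atMost]]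
  by (rule sum.reindex_bij_witness[of _ prod.swap prod.swap]) auto

lemma sum_atMost_rev: "(\<Sum>s\<le>n. f s) = (\<Sum>s\<le>n::nat. f (n - s))"
  using sum.nat_diff_reindex[of f "Suc n"] by (simp add: lessThan_Suc_atMost)

lemma sum_binomial_rev:
  fixes h :: "nat \<Rightarrow> 'a::comm_semiring_1"
  shows "(\<Sum>s\<le>n. of_nat (n choose s) * h s) = (\<Sum>s\<le>n. of_nat (n choose s) * h (n - s))"
  by (subst sum_atMost_rev) (rule sum.cong, simp_all add: binomial_symmetric[symmetric])

text \<open>
  The left-hand side is what the composite of two binomially convolved operators produces, the
  right-hand side is the shape of the associativity law of conformal algebras.
\<close>

lemma sum_binomial_associativity:
  fixes F :: "nat \<Rightarrow> nat \<Rightarrow> nat \<Rightarrow> 'a::comm_semiring_1"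
  shows "(\<Sum>s\<le>n. of_nat (n choose s) * (\<Sum>u\<le>m. of_nat (m choose u) *
      (\<Sum>q\<le>n - s. of_nat (n - s choose q) * F (s + u) (n - s - q) (m - u + q))))
    = (\<Sum>s\<le>n. of_nat (n choose s) * (\<Sum>w\<le>m + s. of_nat (m + s choose w) * F w (n - s) (m + s - w)))"
proof -
  \<comment> \<open>Summing over l = n - s - q instead of q makes \<open>F\<close> depend on s and u
    only through s + u, so that Vandermonde can merge the two sums.\<close>
  have *: "(\<Sum>q\<le>n - s. of_nat (n - s choose q) * F (s + u) (n - s - q) (m - u + q))
     = (\<Sum>l\<le>n - s. of_nat (n - s choose l) * F (s + u) l (m + (n - l) - (s + u)))"
    if "s \<le> n" "u \<le> m" for s u
    by (subst sum_binomial_rev, rule sum.cong)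
      (use that in \<open>auto simp: Suc_diff_le intro!: arg_cong2[where f = "(*)"] arg_cong[where f = "F (s + u) _"]\<close>)
  \<comment> \<open>Both products are the trinomial coefficient n! / (s! l! (n - s - l)!), so l can
    become the outer index.\<close>
  have choose: "of_nat (n choose s) * (of_nat (n - s choose l) * x)
      = of_nat (n choose l) * (of_nat (n - l choose s) * (x::'a))" if "s \<le> n" "l \<le> n - s" for s l x
  proof -
    have "(n choose s) * (n - s choose l) = (n choose l) * (n - l choose s)"
    proof -
      have "(n choose (s + l)) * (s + l choose s) = (n choose s) * (n - s choose l)"
        using choose_mult[of s "s + l" n] that by simp
      moreover have "(n choose (s + l)) * (s + l choose l) = (n choose l) * (n - l choose s)"
        using choose_mult[of l "s + l" n] that by simp
      moreover have "(s + l choose s) = (s + l choose l)"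
        using binomial_symmetric[of s "s + l"] by simp
      ultimately show ?thesis by simp
    qed
    then have "of_nat ((n choose s) * (n - s choose l)) * x = of_nat ((n choose l) * (n - l choose s)) * x"
      by (rule arg_cong)
    then show ?thesis by (simp only: of_nat_mult mult.assoc)
  qed
  have "(\<Sum>s\<le>n. of_nat (n choose s) * (\<Sum>u\<le>m. of_nat (m choose u) *
      (\<Sum>q\<le>n - s. of_nat (n - s choose q) * F (s + u) (n - s - q) (m - u + q))))
     = (\<Sum>s\<le>n. of_nat (n choose s) * (\<Sum>u\<le>m. of_nat (m choose u) *
      (\<Sum>l\<le>n - s. of_nat (n - s choose l) * F (s + u) l (m + (n - l) - (s + u)))))"
    by (intro sum.cong refl arg_cong2[where f = "(*)"] *) auto
  also have "\<dots> = (\<Sum>s\<le>n. \<Sum>l\<le>n - s. of_nat (n choose s) * (of_nat (n - s choose l) *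
      (\<Sum>u\<le>m. of_nat (m choose u) * F (s + u) l (m + (n - l) - (s + u)))))"
    by (intro sum.cong refl, unfold sum_distrib_left, subst sum.swap) (simp only: mult.left_commute)
  also have "\<dots> = (\<Sum>s\<le>n. \<Sum>l\<le>n - s. of_nat (n choose l) * (of_nat (n - l choose s) *
      (\<Sum>u\<le>m. of_nat (m choose u) * F (s + u) l (m + (n - l) - (s + u)))))"
    by (intro sum.cong refl choose) auto
  also have "\<dots> = (\<Sum>l\<le>n. of_nat (n choose l) * (\<Sum>s\<le>n - l. of_nat (n - l choose s) *
      (\<Sum>u\<le>m. of_nat (m choose u) * F (s + u) l (m + (n - l) - (s + u)))))"
    by (subst sum_triangle_swap) (simp add: sum_distrib_left)
  also have "\<dots> = (\<Sum>l\<le>n. of_nat (n choose l) * (\<Sum>w\<le>m + (n - l). of_nat (m + (n - l) choose w) *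
      F w l (m + (n - l) - w)))"
  proof (rule sum.cong[OF refl], rule arg_cong2[where f = "(*)", OF refl])
    fix l
    show "(\<Sum>s\<le>n - l. of_nat (n - l choose s) *
        (\<Sum>u\<le>m. of_nat (m choose u) * F (s + u) l (m + (n - l) - (s + u))))
      = (\<Sum>w\<le>m + (n - l). of_nat (m + (n - l) choose w) * F w l (m + (n - l) - w))"
      using vandermonde_sum[of "n - l" m "\<lambda>w. F w l (m + (n - l) - w)"]
      by (simp only: add.commute[of m])
  qed
  also have "\<dots> = (\<Sum>s\<le>n. of_nat (n choose s) * (\<Sum>w\<le>m + s. of_nat (m + s choose w) * F w (n - s) (m + s - w)))"
    by (subst sum_binomial_rev) (rule sum.cong, auto)
  finally show ?thesis .
qed

text \<open>Absorption: s (n choose s) = n (n - 1 choose s - 1). The factor s kills the term where s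
  - 1 is truncated. This and its mirror image below carry the rules for \<open>D\<close> through
  binomial sums.\<close>

lemma sum_binomial_absorb:
  fixes h :: "nat \<Rightarrow> nat \<Rightarrow> 'a::comm_semiring_1"
  shows "(\<Sum>s\<le>n. of_nat (n choose s) * (of_nat s * h (n - s) (s - 1)))
    = of_nat n * (\<Sum>s\<le>n - 1. of_nat (n - 1 choose s) * h (n - 1 - s) s)"
proof (cases n)
  case (Suc k)
  have *: "of_nat (Suc k choose Suc s) * (of_nat (Suc s) * x)
    = of_nat (Suc k) * (of_nat (k choose s) * (x::'a))" for s x
    by (metis Suc_times_binomial_eq mult.assoc of_nat_mult)
  show ?thesis unfolding Suc
    by (subst sum.atMost_Suc_shift)
      (simp add: * sum_distrib_left del: of_nat_Suc binomial_Suc_Suc)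
qed simp

lemma sum_binomial_absorb_comp:
  fixes h :: "nat \<Rightarrow> nat \<Rightarrow> 'a::comm_semiring_1"
  shows "(\<Sum>s\<le>n. of_nat (n choose s) * (of_nat (n - s) * h (n - s - 1) s))
    = of_nat n * (\<Sum>s\<le>n - 1. of_nat (n - 1 choose s) * h (n - 1 - s) s)"
proof -
  have "(\<Sum>s\<le>n. of_nat (n choose s) * (of_nat (n - s) * h (n - s - 1) s))
     = (\<Sum>s\<le>n. of_nat (n choose s) * (of_nat s * h (s - 1) (n - s)))"
    by (subst sum_binomial_rev) (rule sum.cong, auto)
  also have "\<dots> = of_nat n * (\<Sum>s\<le>n - 1. of_nat (n - 1 choose s) * h s (n - 1 - s))"
    by (rule sum_binomial_absorb)
  also have "(\<Sum>s\<le>n - 1. of_nat (n - 1 choose s) * h s (n - 1 - s))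
     = (\<Sum>s\<le>n - 1. of_nat (n - 1 choose s) * h (n - 1 - s) s)"
    by (subst sum_binomial_rev) (intro sum.cong refl, simp only: atMost_iff diff_diff_cancel)
  finally show ?thesis .
qed

section \<open>Finitely generated torsion-free modules over the polynomial ring\<close>

context H_module
begin

text \<open>Euclidean descent: replacing \<open>x\<close> by a suitable \<open>y\<close> turns the
  other coefficients of the relation into their remainders modulo \<open>u x\<close>. A nonzero
  remainder has smaller degree and takes over the role of \<open>u x\<close>.\<close>

lemma minimal_generating_set_no_relation:
  assumes tf: "torsion_free UNIV"
    and min: "\<And>T. finite T \<Longrightarrow> span T = UNIV \<Longrightarrow> n \<le> card T"
    and "finite S" "card S = n" "span S = UNIV" "(\<Sum>s\<in>S. scale (u s) s) = 0" "x \<in> S" "u x \<noteq> 0"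
  shows False
  using assms(3-)
proof (induction "degree (u x)" arbitrary: S u x rule: less_induct)
  case less
  let ?T = "S - {x}"
  \<comment> \<open>\<open>y\<close> absorbs the quotients, so that the relation becomes
    \<open>scale (u x) y\<close> plus the terms with remainders.\<close>
  define y where "y = x + (\<Sum>s\<in>?T. scale (u s div u x) s)"
  have fT: "finite ?T" and cT: "card ?T < n"
    using less.prems card_Diff1_less[of S x] by auto
  have inT: "(\<Sum>s\<in>?T. scale (u s div u x) s) \<in> span ?T"
    by (intro span_sum span_scale span_base)
  have "x \<in> span (insert y ?T)"
  proof -
    have "y - (\<Sum>s\<in>?T. scale (u s div u x) s) \<in> span (insert y ?T)"
      using span_mono[of ?T "insert y ?T"] inT by (intro span_diff) (auto intro: span_base)
    then show ?thesis by (simp add: y_def)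
  qed
  then have "S \<subseteq> span (insert y ?T)" by (auto intro: span_base)
  then have gen: "span (insert y ?T) = UNIV"
    using span_minimal[OF _ subspace_span] less.prems(3) by blast
  \<comment> \<open>Otherwise \<open>?T\<close> alone would generate with fewer than
    \<open>n\<close> elements. This keeps the new generating set at size \<open>n\<close> and later
    excludes y = 0.\<close>
  have y: "y \<notin> span ?T"
  proof
    assume "y \<in> span ?T"
    then have "insert y ?T \<subseteq> span ?T" by (auto intro: span_base)
    then have "span ?T = UNIV" using gen span_minimal[OF _ subspace_span, of "insert y ?T" ?T] by auto
    then show False using min[OF fT] cT by simp
  qed
  then have yT: "y \<notin> ?T" by (auto intro: span_base)
  define v where "v s = (if s = y then u x else u s mod u x)" for s
  have split: "scale (u s) s = scale (u x) (scale (u s div u x) s) + scale (u s mod u x) s" for s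
    
    by (simp only: scale_scale scale_left_distrib[symmetric] mult_div_mod_eq)
  have "(\<Sum>s\<in>insert y ?T. scale (v s) s) = scale (u x) y + (\<Sum>s\<in>?T. scale (u s mod u x) s)"
  proof -
    have "(\<Sum>s\<in>?T. scale (v s) s) = (\<Sum>s\<in>?T. scale (u s mod u x) s)"
      by (rule sum.cong[OF refl]) (use yT in \<open>auto simp: v_def\<close>)
    then show ?thesis by (simp only: sum.insert[OF fT yT]) (simp add: v_def)
  qed
  also have "\<dots> = scale (u x) x + (\<Sum>s\<in>?T. scale (u s) s)"
    by (simp only: split sum.distrib y_def scale_right_distrib scale_sum_right add.assoc)
  also have "\<dots> = 0"
    using sum.remove[OF less.prems(1,5), of "\<lambda>s. scale (u s) s"] less.prems(4) by (rule_tac trans[OF sym])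
  finally have rel: "(\<Sum>s\<in>insert y ?T. scale (v s) s) = 0" .
  show False
  proof (cases "\<exists>s\<in>?T. u s mod u x \<noteq> 0")
    case True
    then obtain s where s: "s \<in> ?T" "u s mod u x \<noteq> 0" by blast
    then have vs: "v s = u s mod u x" using yT by (auto simp: v_def)
    show False
    proof (rule less.hyps[of v s "insert y ?T"])
      show "degree (v s) < degree (u x)"
        using degree_mod_less'[OF less.prems(6) s(2)] by (simp only: vs)
      show "card (insert y ?T) = n" 
        using card.remove[OF less.prems(1,5)] less.prems(2) card_insert_disjoint[OF fT yT] by linarith
      show "s \<in> insert y ?T" "v s \<noteq> 0" using s vs by auto
    qed (use fT gen rel in simp_all)
  next
    \<comment> \<open>With all remainders zero the relation is \<open>scale (u x) y = 0\<close>, and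
      torsion-freeness forces y = 0.\<close>
    case False
    have "(\<Sum>s\<in>?T. scale (v s) s) = 0"
      by (rule sum.neutral) (use False yT in \<open>auto simp: v_def\<close>)
    then have "scale (u x) y = 0"
      using rel fT yT by (simp add: v_def)
    then have "y = 0" using tf less.prems(6) by (auto simp: torsion_free_def)
    then show False using y span_zero by simp
  qed
qed

lemma torsion_free_imp_free:
  assumes fg: "finitely_generated UNIV" and tf: "torsion_free UNIV"
  shows "free_finitely_generated UNIV"
proof -
  let ?P = "\<lambda>S. finite S \<and> span S = UNIV"
  obtain S\<^sub>0 where "?P S\<^sub>0" using fg unfolding finitely_generated_def by blast
  from ex_has_least_nat[of ?P, OF this, of card]
  obtain S where *: "?P S \<and> (\<forall>T. ?P T \<longrightarrow> card S \<le> card T)" ..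
  then have S: "finite S" "span S = UNIV" by simp_all
  have min: "card S \<le> card T" if "finite T" "span T = UNIV" for T
    using * that by simp
  have "\<not> dependent S"
  proof
    assume "dependent S"
    then obtain u x where "x \<in> S" "u x \<noteq> 0" "(\<Sum>s\<in>S. scale (u s) s) = 0"
      unfolding dependent_finite[OF S(1)] by blast
    then show False
      using minimal_generating_set_no_relation[OF tf min S(1) refl S(2), of u x] by simp
  qed
  then show ?thesis using S unfolding free_finitely_generated_def by blast
qed

end

section \<open>Representations given by scalar matrices\<close>

text \<open>Leibniz rule: only the derivatives of order 0 and 1 of \<open>[:0, 1:]\<close> are
  nonzero.\<close>

lemma higher_pderiv_X_mult:
  "(pderiv ^^ s) ([:0, 1:] * p) = [:0, 1:] * (pderiv ^^ s) p + of_nat s * (pderiv ^^ (s - 1)) p"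
proof (induction s)
  case (Suc s)
  have "of_nat s * pderiv ((pderiv ^^ (s - 1)) p) = of_nat s * (pderiv ^^ s) p"
    by (cases s) auto
  then show ?case
    by (simp add: Suc.IH[simplified] pderiv_add pderiv_pCons pderiv_mult algebra_simps)
qed simp

lemma smult_sum_right: "smult c (sum f A) = (\<Sum>x\<in>A. smult c (f x))"
  by (induction A rule: infinite_finite_induct) (simp_all add: smult_add_right)

lemma higher_pderiv_of_nat_mult: "(pderiv ^^ s) (of_nat n * p) = of_nat n * (pderiv ^^ s) p"
  by (induction s) (simp_all add: pderiv_mult)

interpretation poly_H: H_module "smult :: 'k::field_char_0 poly \<Rightarrow> 'k poly poly \<Rightarrow> 'k poly poly"
  by unfold_locales (simp_all add: smult_add_right smult_add_left)

text \<open>A finite-dimensional representation of the coefficient algebra: \<open>t n a\<close> is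
  the N by N matrix of a(n), and \<open>t_mult\<close> and \<open>t_D\<close> are the defining
  relations of that algebra.\<close>

locale conformal_matrices = associative_conformal_algebra scale prod
  for scale :: "'k::field_char_0 poly \<Rightarrow> 'c::ab_group_add \<Rightarrow> 'c" and prod +
  fixes N :: nat and t :: "nat \<Rightarrow> 'c \<Rightarrow> nat \<Rightarrow> nat \<Rightarrow> 'k"
  assumes t_add: "i < N \<Longrightarrow> j < N \<Longrightarrow> t n (a + b) i j = t n a i j + t n b i j"
    and t_kscale: "i < N \<Longrightarrow> j < N \<Longrightarrow> t n (kscale x a) i j = x * t n a i j"
    and t_D: "i < N \<Longrightarrow> j < N \<Longrightarrow> t n (D a) i j = - of_nat n * t (n - 1) a i j"
    and t_locality: "i < N \<Longrightarrow> j < N \<Longrightarrow> finite {n. t n a i j \<noteq> 0}"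
    and t_mult: "i < N \<Longrightarrow> k < N \<Longrightarrow> (\<Sum>j<N. t n a i j * t m b j k)
      = (\<Sum>s\<le>n. of_nat (n choose s) * t (m + s) (prod (n - s) a b) i k)"
begin

definition entry :: "nat \<Rightarrow> 'c \<Rightarrow> 'k poly poly \<Rightarrow> nat \<Rightarrow> 'k poly" where
  "entry n a v i = (\<Sum>j<N. \<Sum>s\<le>n. of_nat (n choose s) *
     smult (t (n - s) a i j) ((pderiv ^^ s) (coeff v j)))"

text \<open>
  On coordinate vectors \<open>v\<close> over \<open>H\<close> this is
  \<open>a\<^bsub>(\<lambda>)\<^esub> v(D) = T\<^sub>\<lambda>(a) v(D + \<lambda>)\<close>, the only sesquilinear extension of the scalar matrices
  \<open>T\<^sub>\<lambda>(a)\<close>; the derivatives are the Taylor coefficients of \<open>v(D + \<lambda>)\<close>.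
\<close>

definition act :: "nat \<Rightarrow> 'c \<Rightarrow> 'k poly poly \<Rightarrow> 'k poly poly" where
  "act n a v = (\<Sum>i<N. monom (entry n a v i) i)"

text \<open>A copy of H^N in H[x]: the coefficients below \<open>N\<close> are the
  coordinates.\<close>

definition V :: "'k poly poly set" where
  "V = {v. \<forall>i\<ge>N. coeff v i = 0}"

lemma coeff_act: "coeff (act n a v) i = (if i < N then entry n a v i else 0)"
  by (simp add: act_def coeff_sum if_distrib cong: if_cong)

text \<open>The matrix entries are scalars, so derivatives pass through them and compose to order s
  + u. After \<open>t_mult\<close> has replaced the matrix products, the claim is
  \<open>sum_binomial_associativity\<close>.\<close>

lemma entry_mult:
  assumes i: "i < N"
  shows "entry n a (act m b v) i
    = (\<Sum>s\<le>n. of_nat (n choose s) * entry (m + s) (prod (n - s) a b) v i)"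
proof -
  let ?d = "\<lambda>s k. (pderiv ^^ s) (coeff v k)"
  have "entry n a (act m b v) i = (\<Sum>j<N. \<Sum>s\<le>n. \<Sum>k<N. \<Sum>u\<le>m. of_nat (n choose s) *
      (of_nat (m choose u) * smult (t (n - s) a i j * t (m - u) b j k) (?d (s + u) k)))"
    by (simp add: entry_def coeff_act higher_pderiv_sum higher_pderiv_of_nat_mult higher_pderiv_smult
        smult_sum_right sum_distrib_left funpow_add mult_smult_right)
  also have "\<dots> = (\<Sum>k<N. \<Sum>s\<le>n. \<Sum>u\<le>m. \<Sum>j<N. of_nat (n choose s) *
      (of_nat (m choose u) * smult (t (n - s) a i j * t (m - u) b j k) (?d (s + u) k)))"
  proof -
    have swap: "(\<Sum>j<N. \<Sum>s\<le>n. \<Sum>k<N. \<Sum>u\<le>m. g j s k u) = (\<Sum>k<N. \<Sum>s\<le>n. \<Sum>u\<le>m. \<Sum>j<N. g j s k u)"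
      for g :: "nat \<Rightarrow> nat \<Rightarrow> nat \<Rightarrow> nat \<Rightarrow> 'k poly"
    proof -
      have "(\<Sum>j<N. \<Sum>s\<le>n. \<Sum>k<N. \<Sum>u\<le>m. g j s k u) = (\<Sum>s\<le>n. \<Sum>j<N. \<Sum>k<N. \<Sum>u\<le>m. g j s k u)"
        by (rule sum.swap)
      also have "\<dots> = (\<Sum>s\<le>n. \<Sum>k<N. \<Sum>j<N. \<Sum>u\<le>m. g j s k u)"
        by (rule sum.cong[OF refl], rule sum.swap)
      also have "\<dots> = (\<Sum>k<N. \<Sum>s\<le>n. \<Sum>j<N. \<Sum>u\<le>m. g j s k u)"
        by (rule sum.swap)
      also have "\<dots> = (\<Sum>k<N. \<Sum>s\<le>n. \<Sum>u\<le>m. \<Sum>j<N. g j s k u)"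
        by (rule sum.cong[OF refl], rule sum.cong[OF refl], rule sum.swap)
      finally show ?thesis .
    qed
    show ?thesis by (rule swap)
  qed
  also have "\<dots> = (\<Sum>k<N. \<Sum>s\<le>n. of_nat (n choose s) * (\<Sum>u\<le>m. of_nat (m choose u) *
      smult (\<Sum>j<N. t (n - s) a i j * t (m - u) b j k) (?d (s + u) k)))"
    by (simp add: sum_distrib_left smult_sum)
  also have "\<dots> = (\<Sum>k<N. \<Sum>s\<le>n. of_nat (n choose s) * (\<Sum>u\<le>m. of_nat (m choose u) *
      (\<Sum>q\<le>n - s. of_nat (n - s choose q) *
        smult (t (m - u + q) (prod (n - s - q) a b) i k) (?d (s + u) k))))"
  proof -
    have "smult (\<Sum>j<N. t (n - s) a i j * t (m - u) b j k) p = (\<Sum>q\<le>n - s. of_nat (n - s choose q) *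
        smult (t (m - u + q) (prod (n - s - q) a b) i k) p)" if "k < N" for s u k p
      unfolding t_mult[OF i that] smult_sum
      by (rule sum.cong[OF refl]) (simp add: of_nat_poly mult.commute)
    then show ?thesis by simp
  qed
  also have "\<dots> = (\<Sum>k<N. \<Sum>s\<le>n. of_nat (n choose s) * (\<Sum>w\<le>m + s. of_nat (m + s choose w) *
        smult (t (m + s - w) (prod (n - s) a b) i k) (?d w k)))"
    by (subst sum_binomial_associativity[of _ _ "\<lambda>w l r. smult (t r (prod l a b) i k) (?d w k)" for k]) (rule refl)
  also have "\<dots> = (\<Sum>s\<le>n. of_nat (n choose s) * entry (m + s) (prod (n - s) a b) v i)"
    by (subst sum.swap) (simp add: entry_def sum_distrib_left)
  finally show ?thesis .
qed

lemma entry_D_right: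
  "entry n a (smult [:0, 1:] v) i = [:0, 1:] * entry n a v i + of_nat n * entry (n - 1) a v i"
proof -
  define X :: "'k poly" where "X = [:0, 1:]"
  define h where "h j r s = smult (t r a i j) ((pderiv ^^ s) (coeff v j))" for j r s
  have *: "smult (t r a i j) ((pderiv ^^ s) (coeff (smult X v) j)) = X * h j r s + of_nat s * h j r (s - 1)"
    for j r s
    unfolding coeff_smult X_def higher_pderiv_X_mult h_def by (simp only: smult_add_right mult_smult_right)
  have "entry n a (smult X v) i
    = (\<Sum>j<N. \<Sum>s\<le>n. of_nat (n choose s) * (X * h j (n - s) s + of_nat s * h j (n - s) (s - 1)))"
    unfolding entry_def * ..
  also have "\<dots> = X * (\<Sum>j<N. \<Sum>s\<le>n. of_nat (n choose s) * h j (n - s) s)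
     + (\<Sum>j<N. \<Sum>s\<le>n. of_nat (n choose s) * (of_nat s * h j (n - s) (s - 1)))"
    by (simp only: sum_distrib_left distrib_left sum.distrib mult.left_commute)
  also have "\<dots> = X * entry n a v i + of_nat n * entry (n - 1) a v i"
    unfolding sum_binomial_absorb by (simp only: sum_distrib_left entry_def h_def)
  finally show ?thesis unfolding X_def .
qed

lemma entry_D_left:
  assumes i: "i < N"
  shows "entry n (D a) v i = - of_nat n * entry (n - 1) a v i"
proof -
  define h where "h j r s = smult (t r a i j) ((pderiv ^^ s) (coeff v j))" for j r s
  have *: "smult (t r (D a) i j) ((pderiv ^^ s) (coeff v j)) = - (of_nat r * h j (r - 1) s)"
    if "j < N" for j r s
    by (simp add: t_D i that h_def of_nat_poly mult.commute)
  have "entry n (D a) v i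
    = - (\<Sum>j<N. \<Sum>s\<le>n. of_nat (n choose s) * (of_nat (n - s) * h j (n - s - 1) s))"
    unfolding entry_def by (simp add: * sum_negf del: of_nat_diff)
  also have "\<dots> = - of_nat n * entry (n - 1) a v i"
    unfolding sum_binomial_absorb_comp mult_minus_left
    by (simp only: sum_distrib_left entry_def h_def)
  finally show ?thesis .
qed

text \<open>A nonzero term needs n - s at most \<open>K\<close>, the bound for the matrices, and s
  at most \<open>e\<close>, the bound for the degrees of the coordinates.\<close>

lemma finite_act_nonzero: "finite {n. act n a v \<noteq> 0}"
proof -
  define e where "e = (\<Sum>j<N. degree (coeff v j))"
  have e: "degree (coeff v j) \<le> e" if "j < N" for j
    unfolding e_def using that by (intro member_le_sum) auto
  have "finite (\<Union>i<N. \<Union>j<N. {n. t n a i j \<noteq> 0})"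
    using t_locality by blast
  then obtain K where K: "\<And>n i j. i < N \<Longrightarrow> j < N \<Longrightarrow> t n a i j \<noteq> 0 \<Longrightarrow> n \<le> K"
    unfolding finite_nat_set_iff_bounded_le by blast
  have "act n a v = 0" if n: "n > K + e" for n
  proof -
    have zero: "of_nat (n choose s) * smult (t (n - s) a i j) ((pderiv ^^ s) (coeff v j)) = 0"
      if "i < N" "j < N" for i j s
    proof (cases "s \<le> e")
      case True
      then have "t (n - s) a i j = 0" using K[OF that, of "n - s"] n by linarith
      then show ?thesis by simp
    next
      case False
      then have "(pderiv ^^ s) (coeff v j) = 0"
        using e[OF that(2)] by (intro poly_eqI) (simp add: coeff_higher_pderiv coeff_eq_0)
      then show ?thesis by simp
    qed
    have "entry n a v i = 0" if "i < N" for i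
      unfolding entry_def by (intro sum.neutral ballI zero that) simp
    then show ?thesis unfolding act_def by simp
  qed
  then have "{n. act n a v \<noteq> 0} \<subseteq> {..K + e}" by (auto simp: not_less[symmetric])
  then show ?thesis by (rule finite_subset) simp
qed

lemma conformal_representation_act: "conformal_representation scale prod smult V act"
proof (unfold_locales)
  show "poly_H.subspace V"
    by (auto simp: poly_H.subspace_def V_def)
  fix n m a b v w x
  show "act n a v \<in> V" by (simp add: V_def coeff_act)
  show "act n (a + b) v = act n a v + act n b v"
    by (rule poly_eqI)
      (simp add: coeff_act entry_def t_add smult_add_left distrib_left sum.distrib)
  show "act n (kscale x a) v = poly_H.kscale x (act n a v)"
    by (rule poly_eqI)
      (simp add: coeff_act entry_def t_kscale poly_H.kscale_def smult_sum_right mult_smult_right)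
  show "act n a (v + w) = act n a v + act n a w"
    by (rule poly_eqI)
      (simp add: coeff_act entry_def higher_pderiv_add smult_add_right distrib_left sum.distrib)
  show "act n a (poly_H.kscale x v) = poly_H.kscale x (act n a v)"
    by (rule poly_eqI)
      (simp add: coeff_act entry_def poly_H.kscale_def higher_pderiv_smult smult_sum_right
        mult_smult_right mult.commute)
  show "finite {n. act n a v \<noteq> 0}" by (rule finite_act_nonzero)
  show "act n (D a) v = poly_H.kscale (- of_nat n) (act (n - 1) a v)"
    by (rule poly_eqI)
      (simp add: coeff_act entry_D_left poly_H.kscale_def of_nat_poly)
  show "act n a (poly_H.D v) = poly_H.D (act n a v) + poly_H.kscale (of_nat n) (act (n - 1) a v)"
    by (rule poly_eqI)
      (simp add: coeff_act entry_D_right poly_H.D_def poly_H.kscale_def of_nat_poly)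
  show "act n a (act m b v) =
      (\<Sum>s\<le>n. poly_H.kscale (of_nat (n choose s)) (act (m + s) (prod (n - s) a b) v))"
    by (rule poly_eqI)
      (simp add: coeff_act entry_mult poly_H.kscale_def of_nat_poly coeff_sum)
qed

lemma free_V: "poly_H.free_finitely_generated V"
proof -
  let ?e = "\<lambda>i. monom (1::'k poly) i"
  have inj: "inj_on ?e {..<N}" by (auto simp: inj_on_def monom_eq_iff')
  have eq: "(\<Sum>v\<in>?e ` {..<N}. smult (u v) v) = (\<Sum>i<N. monom (u (?e i)) i)" for u
    by (simp add: sum.reindex[OF inj] smult_monom)
  have "\<not> poly_H.dependent (?e ` {..<N})"
  proof
    assume "poly_H.dependent (?e ` {..<N})"
    then obtain u :: "'k poly poly \<Rightarrow> 'k poly" and i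
      where u: "i < N" "u (?e i) \<noteq> 0" "(\<Sum>i<N. monom (u (?e i)) i) = 0"
      unfolding poly_H.dependent_finite[OF finite_imageI[OF finite_lessThan]] eq by blast
    have "u (?e i) = coeff (\<Sum>i<N. monom (u (?e i)) i) i"
      using u(1) by (simp add: coeff_sum if_distrib cong: if_cong)
    also have "\<dots> = 0" unfolding u(3) by simp
    finally show False using u(2) by simp
  qed
  moreover have "poly_H.span (?e ` {..<N}) = V"
  proof
    show "poly_H.span (?e ` {..<N}) \<subseteq> V"
      by (rule poly_H.span_minimal) (auto simp: V_def poly_H.subspace_def)
    show "V \<subseteq> poly_H.span (?e ` {..<N})"
    proof
      fix v assume v: "v \<in> V"
      have "v = (\<Sum>i<N. smult (coeff v i) (?e i))"
        using v by (intro poly_eqI) (simp add: V_def coeff_sum if_distrib cong: if_cong)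
      also have "\<dots> \<in> poly_H.span (?e ` {..<N})"
        by (intro poly_H.span_sum poly_H.span_scale poly_H.span_base) auto
      finally show "v \<in> poly_H.span (?e ` {..<N})" .
    qed
  qed
  ultimately show ?thesis
    unfolding poly_H.free_finitely_generated_def by (blast intro: finite_imageI)
qed

text \<open>On a constant basis vector all derivatives of positive order vanish, so the action
  returns a column of \<open>t n a\<close>.\<close>

lemma faithful_act:
  assumes "\<And>a. (\<And>n i j. i < N \<Longrightarrow> j < N \<Longrightarrow> t n a i j = 0) \<Longrightarrow> a = 0"
  shows "conformal_representation.faithful V act"
proof -
  have "t n a i j = 0" if a: "\<forall>n. \<forall>v\<in>V. act n a v = 0" and ij: "i < N" "j < N" for n a i j
  proof -
    have "monom 1 j \<in> V" using ij by (auto simp: V_def)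
    then have "coeff (coeff (act n a (monom 1 j)) i) 0 = 0" using a by simp
    moreover have "entry n a (monom 1 j) i = [:t n a i j:]"
    proof -
      have "(\<Sum>s\<le>n. of_nat (n choose s) * smult (t (n - s) a i k) ((pderiv ^^ s) (coeff (monom 1 j) k)))
        = (if k = j then [:t n a i j:] else 0)" for k
      proof -
        have "(pderiv ^^ s) 1 = (if s = 0 then 1 else 0 :: 'k poly)" for s
          by (cases s) (simp_all add: funpow_Suc_right del: funpow.simps)
        then have "of_nat (n choose s) * smult (t (n - s) a i k) ((pderiv ^^ s) (coeff (monom 1 j) k))
            = (if s = 0 then if k = j then [:t n a i j:] else 0 else 0)" for s
          by simp
        then show ?thesis by simp
      qed
      then show ?thesis using ij by (simp add: entry_def)
    qed
    ultimately show ?thesis using ij by (simp add: coeff_act)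
  qed
  then show ?thesis
    unfolding conformal_representation.faithful_def[OF conformal_representation_act]
    using assms by blast
qed

end

section \<open>Functionals on the coefficient algebra\<close>

definition fscale :: "'k::field \<Rightarrow> ('a \<Rightarrow> 'k) \<Rightarrow> 'a \<Rightarrow> 'k" where
  "fscale c f = (\<lambda>x. c * f x)"

lemma fscale_apply [simp]: "fscale c f x = c * f x"
  by (simp add: fscale_def)

interpretation functional: vector_space "fscale :: 'k::field \<Rightarrow> ('a \<Rightarrow> 'k) \<Rightarrow> 'a \<Rightarrow> 'k"
  by unfold_locales (simp_all add: fun_eq_iff algebra_simps)

lemma sum_apply: "(sum F A) x = (\<Sum>i\<in>A. F i x)"
  by (induction A rule: infinite_finite_induct) simp_all

context associative_conformal_algebra
begin

text \<open>
  Let \<open>A\<^sub>+\<close> be the algebra of coefficients of \<open>C\<close>, spanned by symbols \<open>a(n)\<close> subject to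
  \<open>(D a)(n) = - n a(n-1)\<close>. A coherent function on \<^typ>\<open>(nat \<times> 'c) option\<close> is a linear functional
  on \<open>A\<^sub>+\<close> with an identity adjoined; \<^const>\<open>None\<close> is the identity and
  \<open>Some (n, a)\<close> is \<open>a(n)\<close>.
\<close>

definition coherent :: "((nat \<times> 'c) option \<Rightarrow> 'k) \<Rightarrow> bool" where
  "coherent f \<longleftrightarrow>
    (\<forall>n a b. f (Some (n, a + b)) = f (Some (n, a)) + f (Some (n, b))) \<and>
    (\<forall>n x a. f (Some (n, kscale x a)) = x * f (Some (n, a))) \<and>
    (\<forall>n a. f (Some (n, D a)) = - of_nat n * f (Some (n - 1, a)))"

text \<open>The right action dual to left multiplication by \<open>a(n)\<close>.\<close>

definition ract :: "nat \<Rightarrow> 'c \<Rightarrow> ((nat \<times> 'c) option \<Rightarrow> 'k) \<Rightarrow> (nat \<times> 'c) option \<Rightarrow> 'k" where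
  "ract n a f z = (case z of None \<Rightarrow> f (Some (n, a))
    | Some (m, b) \<Rightarrow> \<Sum>s\<le>n. of_nat (n choose s) * f (Some (m + s, prod (n - s) a b)))"

lemma ract_None [simp]: "ract n a f None = f (Some (n, a))"
  and ract_Some: "ract n a f (Some (m, b)) = (\<Sum>s\<le>n. of_nat (n choose s) * f (Some (m + s, prod (n - s) a b)))"
  by (simp_all add: ract_def)

lemma coherent_add: "coherent f \<Longrightarrow> f (Some (n, a + b)) = f (Some (n, a)) + f (Some (n, b))"
  and coherent_kscale: "coherent f \<Longrightarrow> f (Some (n, kscale x a)) = x * f (Some (n, a))"
  and coherent_D: "coherent f \<Longrightarrow> f (Some (n, D a)) = - of_nat n * f (Some (n - 1, a))"
  unfolding coherent_def by blast+

lemma coherent_zero: "coherent f \<Longrightarrow> f (Some (n, 0)) = 0"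
  using coherent_add[of f n 0 0] by simp

lemma coherent_sum: "coherent f \<Longrightarrow> f (Some (n, sum g A)) = (\<Sum>i\<in>A. f (Some (n, g i)))"
  by (induction A rule: infinite_finite_induct) (simp_all add: coherent_zero coherent_add)

lemma subspace_coherent: "functional.subspace {f. coherent f}"
  by (auto simp: functional.subspace_def coherent_def algebra_simps)

text \<open>The Horner step: induction on polynomials reduces claims about \<open>scale\<close> to
  \<open>kscale\<close> and \<open>D\<close>.\<close>

lemma scale_pCons: "scale (pCons x p) a = kscale x a + D (scale p a)"
  unfolding kscale_def D_def scale_scale scale_left_distrib[symmetric] by simp

text \<open>Iterating the rule for \<open>D\<close> gives (D^r a)(n) = (-1)^r n!/(n-r)! a(n-r) for r
  up to n, and 0 beyond; here r = n - m.\<close>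

lemma coherent_scale:
  assumes f: "coherent f"
  shows "f (Some (n, scale p a))
    = (\<Sum>m\<le>n. (- 1) ^ (n - m) * fact n / fact m * coeff p (n - m) * f (Some (m, a)))"
proof (induction p arbitrary: n)
  case 0
  then show ?case using coherent_zero[OF f] by simp
next
  case (pCons x p)
  show ?case
  proof (cases n)
    case 0
    then show ?thesis
      by (simp add: scale_pCons coherent_add[OF f] coherent_kscale[OF f] coherent_D[OF f])
  next
    case (Suc k)
    have "- of_nat (Suc k) * ((- 1) ^ (k - m) * fact k / fact m * coeff p (k - m) * f (Some (m, a)))
      = (- 1) ^ (Suc k - m) * fact (Suc k) / fact m * coeff (pCons x p) (Suc k - m) * f (Some (m, a))"
      if "m \<le> k" for m
      using that by (simp add: Suc_diff_le field_simps)
    then have "(\<Sum>m\<le>k. - of_nat (Suc k) * ((- 1) ^ (k - m) * fact k / fact m * coeff p (k - m) * f (Some (m, a))))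
      = (\<Sum>m\<le>k. (- 1) ^ (Suc k - m) * fact (Suc k) / fact m * coeff (pCons x p) (Suc k - m) * f (Some (m, a)))"
      by (intro sum.cong refl) simp
    then show ?thesis
      by (simp add: Suc scale_pCons coherent_add[OF f] coherent_kscale[OF f] coherent_D[OF f] pCons.IH
          sum_distrib_left del: of_nat_Suc)
  qed
qed

lemma ract_add_left: "coherent f \<Longrightarrow> ract n (a + b) f = ract n a f + ract n b f"
  by (auto simp: fun_eq_iff ract_def coherent_add prod_add_left distrib_left sum.distrib split: option.split)

lemma ract_kscale_left: "coherent f \<Longrightarrow> ract n (kscale x a) f = fscale x (ract n a f)"
  by (auto simp: fun_eq_iff ract_def coherent_kscale prod_kscale_left sum_distrib_left algebra_simps
      split: option.split)

lemma ract_D_left: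
  assumes f: "coherent f"
  shows "ract n (D a) f = fscale (- of_nat n) (ract (n - 1) a f)"
proof
  fix z
  show "ract n (D a) f z = fscale (- of_nat n) (ract (n - 1) a f) z"
  proof (cases z)
    case None
    then show ?thesis by (simp add: coherent_D[OF f])
  next
    case (Some y)
    obtain m b where y: "y = (m, b)" by (cases y)
    have "ract n (D a) f z
      = - (\<Sum>s\<le>n. of_nat (n choose s) * (of_nat (n - s) * f (Some (m + s, prod (n - s - 1) a b))))"
      by (simp add: Some y ract_Some prod_D_left coherent_kscale[OF f] sum_negf del: of_nat_diff)
    also have "\<dots> = - of_nat n * (\<Sum>s\<le>n - 1. of_nat (n - 1 choose s) * f (Some (m + s, prod (n - 1 - s) a b)))"
      using sum_binomial_absorb_comp[of n "\<lambda>r s. f (Some (m + s, prod r a b))"] by simp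
    finally show ?thesis by (simp add: Some y ract_Some)
  qed
qed

lemma ract_add_right: "ract n a (f + g) = ract n a f + ract n a g"
  by (auto simp: fun_eq_iff ract_def distrib_left sum.distrib split: option.split)

lemma ract_fscale: "ract n a (fscale c f) = fscale c (ract n a f)"
  by (auto simp: fun_eq_iff ract_def sum_distrib_left algebra_simps split: option.split)

lemma ract_zero: "ract n a 0 = 0"
  by (auto simp: fun_eq_iff ract_def split: option.split)

lemma ract_sum: "ract n a (sum F A) = (\<Sum>i\<in>A. ract n a (F i))"
  by (induction A rule: infinite_finite_induct)
    (simp_all only: sum.infinite sum.empty sum.insert ract_add_right ract_zero if_False not_False_eq_True)

text \<open>The factor m + s from the rule for \<open>D\<close> splits. The m part is the claim; the
  s part and the extra term of \<open>prod_D_right\<close> absorb to the same multiple of the same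
  sum, with opposite signs, and cancel.\<close>

lemma coherent_ract:
  assumes f: "coherent f"
  shows "coherent (ract n a f)"
proof -
  have "ract n a f (Some (m, D b)) = - of_nat m * ract n a f (Some (m - 1, b))" for m b
  proof -
    define h where "h r s = f (Some (m + s, prod r a b))" for r s
    have "ract n a f (Some (m, D b)) = (\<Sum>s\<le>n. of_nat (n choose s) *
        (- of_nat (m + s) * f (Some (m + s - 1, prod (n - s) a b)) + of_nat (n - s) * h (n - s - 1) s))"
      by (simp add: ract_Some prod_D_right coherent_add[OF f] coherent_D[OF f] coherent_kscale[OF f] h_def
          del: of_nat_diff of_nat_add)
    also have "\<dots> = (\<Sum>s\<le>n. of_nat (n choose s) *
        (- of_nat m * f (Some (m - 1 + s, prod (n - s) a b)) - of_nat s * h (n - s) (s - 1)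
          + of_nat (n - s) * h (n - s - 1) s))"
    proof (intro sum.cong refl arg_cong2[where f = "(*)"] arg_cong2[where f = "(+)"])
      fix s
      show "- of_nat (m + s) * f (Some (m + s - 1, prod (n - s) a b))
        = - of_nat m * f (Some (m - 1 + s, prod (n - s) a b)) - of_nat s * h (n - s) (s - 1)"
        by (cases s; cases m) (simp_all add: h_def algebra_simps)
    qed
    also have "\<dots> = - of_nat m * (\<Sum>s\<le>n. of_nat (n choose s) * f (Some (m - 1 + s, prod (n - s) a b)))
        - (\<Sum>s\<le>n. of_nat (n choose s) * (of_nat s * h (n - s) (s - 1)))
        + (\<Sum>s\<le>n. of_nat (n choose s) * (of_nat (n - s) * h (n - s - 1) s))"
      by (simp add: sum.distrib sum_subtractf sum_distrib_left sum_negf distrib_left right_diff_distrib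
          mult.left_commute del: of_nat_diff)
    also have "\<dots> = - of_nat m * ract n a f (Some (m - 1, b))"
      unfolding sum_binomial_absorb sum_binomial_absorb_comp by (simp add: ract_Some)
    finally show ?thesis .
  qed
  then show ?thesis
    using f by (auto simp: coherent_def[of "ract n a f"] ract_Some prod_add_right prod_kscale_right
        coherent_add coherent_kscale distrib_left sum.distrib sum_distrib_left mult.left_commute)
qed

text \<open>Acting by a(n) and then by b(m) is acting by the product a(n) b(m), as befits a right
  action.\<close>

lemma ract_ract:
  assumes f: "coherent f"
  shows "ract m b (ract n a f)
    = (\<Sum>s\<le>n. fscale (of_nat (n choose s)) (ract (m + s) (prod (n - s) a b) f))"
proof
  fix z
  show "ract m b (ract n a f) z
    = (\<Sum>s\<le>n. fscale (of_nat (n choose s)) (ract (m + s) (prod (n - s) a b) f)) z"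
  proof (cases z)
    case None
    then show ?thesis by (simp add: ract_Some sum_apply)
  next
    case (Some y)
    obtain l c where y: "y = (l, c)" by (cases y)
    have "ract m b (ract n a f) z = (\<Sum>u\<le>m. of_nat (m choose u) * (\<Sum>s\<le>n. of_nat (n choose s) *
        (\<Sum>q\<le>n - s. of_nat (n - s choose q) * f (Some (l + (s + u), prod (m - u + q) (prod (n - s - q) a b) c)))))"
      by (simp add: Some y ract_Some prod_assoc coherent_sum[OF f] coherent_kscale[OF f] add_ac)
    also have "\<dots> = (\<Sum>s\<le>n. of_nat (n choose s) * (\<Sum>u\<le>m. of_nat (m choose u) *
        (\<Sum>q\<le>n - s. of_nat (n - s choose q) * f (Some (l + (s + u), prod (m - u + q) (prod (n - s - q) a b) c)))))"
      unfolding sum_distrib_left by (subst sum.swap) (simp only: mult.left_commute)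
    also have "\<dots> = (\<Sum>s\<le>n. of_nat (n choose s) * (\<Sum>w\<le>m + s. of_nat (m + s choose w) *
        f (Some (l + w, prod (m + s - w) (prod (n - s) a b) c))))"
      by (rule sum_binomial_associativity)
    finally show ?thesis by (simp add: Some y ract_Some sum_apply)
  qed
qed

end

section \<open>Coordinate functionals and the finite-dimensional right module they generate\<close>

locale based_conformal_algebra = associative_conformal_algebra scale prod
  for scale :: "'k::field_char_0 poly \<Rightarrow> 'c::ab_group_add \<Rightarrow> 'c" and prod +
  fixes B :: "'c set"
  assumes finite_B: "finite B" and independent_B: "independent B" and span_B: "span B = UNIV"
begin

abbreviation coord :: "'c \<Rightarrow> 'c \<Rightarrow> 'k poly" where
  "coord a j \<equiv> representation B a j"

lemma coord_add: "coord (a + b) j = coord a j + coord b j"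
  and coord_scale: "coord (scale p a) j = p * coord a j"
  and coord_sum: "(\<Sum>j\<in>B. scale (coord a j) j) = a"
  by (simp_all add: representation_add[OF independent_B] representation_scale[OF independent_B]
      sum_representation_eq[OF independent_B] span_B finite_B)

lemma coord_D: "coord (D a) j = pCons 0 (coord a j)"
  and coord_kscale: "coord (kscale x a) j = smult x (coord a j)"
  by (simp_all add: D_def kscale_def coord_scale)

text \<open>
  Since the \<open>j(m)\<close> with \<open>j \<in> B\<close> form a basis of the coefficient algebra and
  \<open>(D\<^sup>t j)(n) = (-1)\<^sup>t n!/(n-t)! j(n-t)\<close>, this is the functional reading off the coefficient at
  \<open>j(m)\<close>, extended by \<open>0\<close> to the identity.
\<close>

definition coord_fun :: "'c \<Rightarrow> nat \<Rightarrow> (nat \<times> 'c) option \<Rightarrow> 'k" where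
  "coord_fun j m z = (case z of None \<Rightarrow> 0 | Some (n, b) \<Rightarrow>
     if m \<le> n then (- 1) ^ (n - m) * fact n / fact m * coeff (coord b j) (n - m) else 0)"

definition unit_fun :: "(nat \<times> 'c) option \<Rightarrow> 'k" where
  "unit_fun z = (if z = None then 1 else 0)"

lemma coherent_coord_fun: "coherent (coord_fun j m)"
proof -
  have "coord_fun j m (Some (n, D b)) = - of_nat n * coord_fun j m (Some (n - 1, b))" for n b
  proof -
    \<comment> \<open>For n = m the left side vanishes because the coordinates of \<open>D b\<close>
      have no constant term, the right side because n - 1 < m or, when n = 0, because of the factor
      n.\<close>
    consider "n < m" | "n = m" | k where "n = Suc k" "m \<le> k"
      by (metis le_Suc_eq less_or_eq_imp_le linorder_less_linear not_less_eq_eq old.nat.exhaust zero_le)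
    then show ?thesis
      by cases (auto simp: coord_fun_def coord_D Suc_diff_le field_simps)
  qed
  then show ?thesis
    by (simp add: coherent_def coord_fun_def coord_add coord_kscale algebra_simps add_divide_distrib)
qed

text \<open>A coherent functional is determined by its values at the identity and at the basis
  elements j(m). Vanishing above \<open>d\<close> makes the expansion finite.\<close>

lemma coherent_expansion:
  assumes g: "coherent g" and vanish: "\<And>m j. m > d \<Longrightarrow> j \<in> B \<Longrightarrow> g (Some (m, j)) = 0"
  shows "g = fscale (g None) unit_fun + (\<Sum>j\<in>B. \<Sum>m\<le>d. fscale (g (Some (m, j))) (coord_fun j m))"
proof
  fix z
  show "g z = (fscale (g None) unit_fun + (\<Sum>j\<in>B. \<Sum>m\<le>d. fscale (g (Some (m, j))) (coord_fun j m))) z"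
  proof (cases z)
    case None
    then show ?thesis by (simp add: sum_apply unit_fun_def coord_fun_def)
  next
    case (Some y)
    obtain n b where y: "y = (n, b)" by (cases y)
    let ?h = "\<lambda>j m. (- 1) ^ (n - m) * fact n / fact m * coeff (coord b j) (n - m) * g (Some (m, j))"
    have "g (Some (n, b)) = (\<Sum>j\<in>B. g (Some (n, scale (coord b j) j)))"
      using coherent_sum[OF g, of n "\<lambda>j. scale (coord b j) j" B] by (simp add: coord_sum)
    also have "\<dots> = (\<Sum>j\<in>B. \<Sum>m\<le>n. ?h j m)"
      by (simp only: coherent_scale[OF g])
    also have "\<dots> = (\<Sum>j\<in>B. \<Sum>m\<le>d. g (Some (m, j)) * coord_fun j m z)"
    proof (rule sum.cong[OF refl])
      fix j assume j: "j \<in> B"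
      have "(\<Sum>m\<le>n. ?h j m) = (\<Sum>m\<in>{..n} \<inter> {..d}. ?h j m)"
        by (rule sum.mono_neutral_right) (use vanish j in \<open>auto simp: not_le\<close>)
      also have "\<dots> = (\<Sum>m\<in>{..n} \<inter> {..d}. g (Some (m, j)) * coord_fun j m z)"
        by (rule sum.cong[OF refl]) (simp add: Some y coord_fun_def)
      also have "\<dots> = (\<Sum>m\<le>d. g (Some (m, j)) * coord_fun j m z)"
        by (rule sum.mono_neutral_left) (auto simp: Some y coord_fun_def)
      finally show "(\<Sum>m\<le>n. ?h j m) = (\<Sum>m\<le>d. g (Some (m, j)) * coord_fun j m z)" .
    qed
    finally show ?thesis by (simp add: Some y sum_apply unit_fun_def)
  qed
qed

text \<open>The bound is uniform in \<open>a\<close>: only finitely many products of basis elements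
  are nonzero, and \<open>D\<close> on the left factor just lowers the index and multiplies by a
  scalar, so no degree grows.\<close>

lemma degree_bound_exists:
  obtains d where "\<And>k a e i. e \<in> B \<Longrightarrow> i \<in> B \<Longrightarrow> degree (coord (prod k a e) i) \<le> d"
proof -
  have "finite (\<Union>j\<in>B. \<Union>e\<in>B. {k. prod k j e \<noteq> 0})"
    using finite_B prod_locality by blast
  then obtain K where K: "\<And>k j e. j \<in> B \<Longrightarrow> e \<in> B \<Longrightarrow> prod k j e \<noteq> 0 \<Longrightarrow> k \<le> K"
    unfolding finite_nat_set_iff_bounded_le by blast
  define d where "d = (\<Sum>k\<le>K. \<Sum>j\<in>B. \<Sum>e\<in>B. \<Sum>i\<in>B. degree (coord (prod k j e) i))"
  have basis: "degree (coord (prod k j e) i) \<le> d" if "j \<in> B" "e \<in> B" "i \<in> B" for k j e i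
  proof (cases "prod k j e = 0")
    case True
    then show ?thesis by (simp add: representation_zero)
  next
    case False
    have "degree (coord (prod k j e) i) \<le> (\<Sum>i\<in>B. degree (coord (prod k j e) i))"
      using that finite_B by (intro member_le_sum) auto
    also have "\<dots> \<le> (\<Sum>e\<in>B. \<Sum>i\<in>B. degree (coord (prod k j e) i))"
      using that finite_B by (intro member_le_sum[where f = "\<lambda>e. \<Sum>i\<in>B. degree (coord (prod k j e) i)"]) auto
    also have "\<dots> \<le> (\<Sum>j\<in>B. \<Sum>e\<in>B. \<Sum>i\<in>B. degree (coord (prod k j e) i))"
      using that finite_B
      by (intro member_le_sum[where f = "\<lambda>j. \<Sum>e\<in>B. \<Sum>i\<in>B. degree (coord (prod k j e) i)"]) auto
    also have "\<dots> \<le> d"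
      unfolding d_def using K[OF that(1,2) False]
      by (intro member_le_sum[where f = "\<lambda>k. \<Sum>j\<in>B. \<Sum>e\<in>B. \<Sum>i\<in>B. degree (coord (prod k j e) i)"]) auto
    finally show ?thesis .
  qed
  let ?P = "\<lambda>a. \<forall>k. \<forall>e\<in>B. \<forall>i\<in>B. degree (coord (prod k a e) i) \<le> d"
  have zero: "?P 0"
    using prod_add_left[of _ 0 0] by (simp add: representation_zero)
  have add: "?P (a + b)" if "?P a" "?P b" for a b
    using that by (auto simp: prod_add_left coord_add intro!: degree_add_le)
  have kscale: "?P (kscale x a)" if "?P a" for x a
    using that by (auto simp: prod_kscale_left coord_kscale intro: order_trans[OF degree_smult_le])
  have D: "?P (D a)" if "?P a" for a
    using that by (auto simp: prod_D_left coord_kscale intro: order_trans[OF degree_smult_le])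
  have scale: "?P (scale p a)" if "?P a" for p a
  proof (induction p)
    case 0
    show ?case unfolding scale_zero_left by (rule zero)
  next
    case (pCons x p)
    show ?case unfolding scale_pCons by (rule add[OF kscale[OF that] D[OF pCons.IH]])
  qed
  have "?P a" for a
  proof -
    have "a \<in> span B" using span_B by simp
    then show "?P a"
      by (induction rule: span_induct_alt) (use zero add scale basis in auto)
  qed
  then show ?thesis using that by blast
qed

text \<open>One application of \<open>ract\<close> suffices: by \<open>ract_ract\<close> iterated
  actions are combinations of single ones, so the span is already a right module.\<close>

definition orbit :: "((nat \<times> 'c) option \<Rightarrow> 'k) set" where
  "orbit = (\<lambda>j. coord_fun j 0) ` B \<union> {ract n a (coord_fun j 0) | n a j. j \<in> B}"

definition bounded_functionals :: "nat \<Rightarrow> ((nat \<times> 'c) option \<Rightarrow> 'k) set" where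
  "bounded_functionals d = {f. coherent f \<and> (\<forall>m>d. \<forall>j\<in>B. f (Some (m, j)) = 0)}"

definition bounded_basis :: "nat \<Rightarrow> ((nat \<times> 'c) option \<Rightarrow> 'k) set" where
  "bounded_basis d = insert unit_fun (\<Union>j\<in>B. \<Union>m\<le>d. {coord_fun j m})"

lemma subspace_bounded_functionals: "functional.subspace (bounded_functionals d)"
  using subspace_coherent unfolding functional.subspace_def bounded_functionals_def by auto

lemma bounded_functionals_subset_span: "bounded_functionals d \<subseteq> functional.span (bounded_basis d)"
proof
  fix g assume g: "g \<in> bounded_functionals d"
  have "fscale (g None) unit_fun + (\<Sum>j\<in>B. \<Sum>m\<le>d. fscale (g (Some (m, j))) (coord_fun j m))
    \<in> functional.span (bounded_basis d)"
    by (intro functional.span_add functional.span_sum functional.span_scale functional.span_base)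
      (auto simp: bounded_basis_def)
  then show "g \<in> functional.span (bounded_basis d)"
    using coherent_expansion[of g d] g by (simp add: bounded_functionals_def)
qed

lemma local_functional:
  assumes "g \<in> bounded_functionals d"
  shows "finite {n. g (Some (n, c)) \<noteq> 0}"
proof -
  let ?S = "{f :: (nat \<times> 'c) option \<Rightarrow> 'k. finite {n. f (Some (n, c)) \<noteq> 0}}"
  have "functional.subspace ?S"
  proof (rule functional.subspaceI)
    fix f g assume "f \<in> ?S" "g \<in> ?S"
    then have "finite ({n. f (Some (n, c)) \<noteq> 0} \<union> {n. g (Some (n, c)) \<noteq> 0})" by simp
    then show "f + g \<in> ?S" unfolding mem_Collect_eq by (rule finite_subset[rotated]) auto
  next
    fix x f assume "f \<in> ?S"
    then show "fscale x f \<in> ?S" unfolding mem_Collect_eq by (rule finite_subset[rotated]) auto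
  qed simp
  moreover have "bounded_basis d \<subseteq> ?S"
  proof -
    have "{n. coord_fun j m (Some (n, c)) \<noteq> 0} \<subseteq> {..m + degree (coord c j)}" for j m
    proof (rule subsetI, unfold mem_Collect_eq)
      fix n assume "coord_fun j m (Some (n, c)) \<noteq> 0"
      then have "coeff (coord c j) (n - m) \<noteq> 0" by (auto simp: coord_fun_def split: if_splits)
      then have "n - m \<le> degree (coord c j)" by (rule le_degree)
      then show "n \<in> {..m + degree (coord c j)}" by auto
    qed
    then have "finite {n. coord_fun j m (Some (n, c)) \<noteq> 0}" for j m
      by (rule finite_subset) simp
    moreover have "finite {n. unit_fun (Some (n, c)) \<noteq> 0}" by (simp add: unit_fun_def)
    ultimately show ?thesis unfolding bounded_basis_def by blast
  qed
  ultimately have "bounded_functionals d \<subseteq> ?S"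
    using functional.span_minimal bounded_functionals_subset_span by blast
  then show ?thesis using assms by blast
qed

text \<open>Functionals in \<open>bounded_functionals d\<close> are determined by finitely many
  values, so it is enough that each value is nonzero for only finitely many n.\<close>

lemma finite_ract_nonzero:
  assumes f: "f \<in> bounded_functionals d" and R: "\<And>n. ract n a f \<in> bounded_functionals d"
  shows "finite {n. ract n a f \<noteq> 0}"
proof -
  have *: "finite {n. ract n a f (Some (m, b)) \<noteq> 0}" for m b
  proof -
    \<comment> \<open>With k = n - s and l = m + s one has n = k + l - m. Locality leaves finitely
      many k, and \<open>local_functional\<close> finitely many l for each.\<close>
    have "finite (\<Union>k\<in>{k. prod k a b \<noteq> 0}. (\<lambda>l. k + l - m) ` {l. f (Some (l, prod k a b)) \<noteq> 0})"
      using prod_locality local_functional[OF f] by blast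
    moreover have "{n. ract n a f (Some (m, b)) \<noteq> 0}
      \<subseteq> (\<Union>k\<in>{k. prod k a b \<noteq> 0}. (\<lambda>l. k + l - m) ` {l. f (Some (l, prod k a b)) \<noteq> 0})"
    proof (rule subsetI, unfold mem_Collect_eq)
      fix n assume "ract n a f (Some (m, b)) \<noteq> 0"
      then obtain s where s: "s \<le> n" "f (Some (m + s, prod (n - s) a b)) \<noteq> 0"
        unfolding ract_Some by (metis (no_types, lifting) atMost_iff mult_zero_right sum.neutral)
      moreover have "prod (n - s) a b \<noteq> 0"
        using s f by (auto simp: bounded_functionals_def coherent_zero)
      moreover have "n = n - s + (m + s) - m" using s(1) by simp
      ultimately show "n \<in> (\<Union>k\<in>{k. prod k a b \<noteq> 0}. (\<lambda>l. k + l - m) ` {l. f (Some (l, prod k a b)) \<noteq> 0})"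
        by blast
    qed
    ultimately show ?thesis by (rule finite_subset[rotated])
  qed
  have "{n. ract n a f \<noteq> 0} \<subseteq> {n. f (Some (n, a)) \<noteq> 0} \<union> (\<Union>m\<le>d. \<Union>j\<in>B. {n. ract n a f (Some (m, j)) \<noteq> 0})"
  proof (rule subsetI, rule ccontr)
    fix n
    assume n: "n \<in> {n. ract n a f \<noteq> 0}"
      and "n \<notin> {n. f (Some (n, a)) \<noteq> 0} \<union> (\<Union>m\<le>d. \<Union>j\<in>B. {n. ract n a f (Some (m, j)) \<noteq> 0})"
    then have "ract n a f None = 0" "\<And>m j. m \<le> d \<Longrightarrow> j \<in> B \<Longrightarrow> ract n a f (Some (m, j)) = 0"
      by auto
    then have "ract n a f = 0"
      using coherent_expansion[of "ract n a f" d] R[of n]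
      by (simp add: bounded_functionals_def)
    then show False using n by simp
  qed
  then show ?thesis
    by (rule finite_subset) (use * local_functional[OF f] finite_B in auto)
qed

lemma ract_span_orbit:
  assumes "f \<in> functional.span orbit"
  shows "ract n a f \<in> functional.span orbit"
  using assms
proof (induction rule: functional.span_induct)
  case base
  show ?case
    by (rule functional.subspaceI; unfold mem_Collect_eq ract_zero ract_add_right ract_fscale)
      (intro functional.span_zero functional.span_add functional.span_scale; assumption)+
next
  case (step f)
  have base: "ract n a (coord_fun j 0) \<in> functional.span orbit" if "j \<in> B" for n a j
    using that by (intro functional.span_base) (auto simp: orbit_def)
  from step consider j where "j \<in> B" "f = coord_fun j 0"
    | m b j where "j \<in> B" "f = ract m b (coord_fun j 0)"
    by (auto simp: orbit_def)
  then show ?case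
  proof cases
    case 1
    show ?thesis unfolding 1(2) by (rule base[OF 1(1)])
  next
    case 2
    show ?thesis
      unfolding 2(2) ract_ract[OF coherent_coord_fun]
      by (intro functional.span_sum functional.span_scale base 2(1))
  qed
qed

lemma span_orbit_bounded:
  obtains d where "functional.span orbit \<subseteq> bounded_functionals d"
proof -
  obtain d where d: "\<And>k a e i. e \<in> B \<Longrightarrow> i \<in> B \<Longrightarrow> degree (coord (prod k a e) i) \<le> d"
    using degree_bound_exists by blast
  \<comment> \<open>The coordinates of a basis element are constants, and m > d forces m >
    0.\<close>
  have "coord_fun i 0 (Some (m, e)) = 0" if "e \<in> B" "m > d" for i m e
    using that by (simp add: coord_fun_def representation_basis[OF independent_B] coeff_eq_0)
  moreover have "ract n a (coord_fun i 0) (Some (m, e)) = 0" if "e \<in> B" "i \<in> B" "m > d" for n a i m e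
    unfolding ract_Some
  proof (rule sum.neutral, rule ballI)
    fix s
    have "degree (coord (prod (n - s) a e) i) < m + s" using d[OF that(1,2), of "n - s" a] that(3) by simp
    then show "of_nat (n choose s) * coord_fun i 0 (Some (m + s, prod (n - s) a e)) = 0"
      by (simp add: coord_fun_def coeff_eq_0)
  qed
  ultimately have "orbit \<subseteq> bounded_functionals d"
    using coherent_coord_fun coherent_ract[OF coherent_coord_fun]
    unfolding orbit_def bounded_functionals_def by auto
  then show ?thesis
    using that functional.span_minimal[OF _ subspace_bounded_functionals] by blast
qed

lemma faithful_matrices_exist:
  "\<exists>N t. conformal_matrices scale prod N t \<and>
    (\<forall>a. (\<forall>n i j. i < N \<longrightarrow> j < N \<longrightarrow> t n a i j = 0) \<longrightarrow> a = 0)"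
proof -
  let ?X = "functional.span orbit"
  obtain d where d: "?X \<subseteq> bounded_functionals d" using span_orbit_bounded .
  then have coh: "coherent f" if "f \<in> ?X" for f
    using that by (auto simp: bounded_functionals_def)
  obtain A where A: "A \<subseteq> ?X" "functional.independent A" "?X \<subseteq> functional.span A"
    by (rule functional.basis_exists[of ?X])
  have span_A: "functional.span A = ?X"
    by (rule equalityI[OF functional.span_minimal[OF A(1) functional.subspace_span] A(3)])
  have "finite (bounded_basis d)" by (simp add: bounded_basis_def finite_B)
  moreover have "A \<subseteq> functional.span (bounded_basis d)"
    using A(1) d bounded_functionals_subset_span by (rule order_trans[OF order_trans])
  ultimately have finite_A: "finite A"
    using functional.independent_span_bound[OF _ A(2)] by simp
  obtain h where h: "bij_betw h {..<card A} A"
    using ex_bij_betw_nat_finite[OF finite_A] by (auto simp: atLeast0LessThan)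
  define N where "N = card A"
  \<comment> \<open>Row i expands the image of \<open>h i\<close>. Rows of a right action multiply
    in the order of the algebra, so the same matrices applied to columns give the left action on the
    dual space.\<close>
  define t where "t n a i j = functional.representation A (ract n a (h i)) (h j)" for n a i j
  have hA: "h i \<in> A" if "i < N" for i
    using h that by (auto simp: bij_betw_def N_def)
  then have hX: "h i \<in> ?X" if "i < N" for i
    using that A(1) by blast
  then have RX: "ract n a (h i) \<in> functional.span A" if "i < N" for n a i
    using ract_span_orbit that by (simp add: span_A)
  have expand: "ract n a (h i) = (\<Sum>j<N. fscale (t n a i j) (h j))" if "i < N" for n a i
  proof -
    have "(\<Sum>j<N. fscale (t n a i j) (h j)) = (\<Sum>b\<in>A. fscale (functional.representation A (ract n a (h i)) b) b)"
      unfolding t_def using h by (intro sum.reindex_bij_betw) (simp add: N_def)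
    also have "\<dots> = ract n a (h i)"
      by (rule functional.sum_representation_eq[OF A(2) RX[OF that] finite_A order_refl])
    finally show ?thesis by simp
  qed
  note rep_add = functional.representation_add[OF A(2)]
    and rep_scale = functional.representation_scale[OF A(2)]
  have rep_sum: "functional.representation A (\<Sum>j\<in>I. fscale (c j) (v j)) x
    = (\<Sum>j\<in>I. c j * functional.representation A (v j) x)"
    if "\<And>j. j \<in> I \<Longrightarrow> v j \<in> functional.span A" for I :: "nat set" and c v x
    using that
    by (subst functional.representation_sum[OF A(2)])
      (auto intro!: sum.cong functional.span_scale simp: rep_scale)
  have "conformal_matrices scale prod N t"
  proof unfold_locales
    fix i j n m a b x
    assume i: "i < N"
    have f: "coherent (h i)" using coh hX i by blast
    show "t n (a + b) i j = t n a i j + t n b i j"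
      by (simp only: t_def ract_add_left[OF f] rep_add[OF RX[OF i] RX[OF i]])
    show "t n (kscale x a) i j = x * t n a i j"
      by (simp only: t_def ract_kscale_left[OF f] rep_scale[OF RX[OF i]])
    show "t n (D a) i j = - of_nat n * t (n - 1) a i j"
      by (simp only: t_def ract_D_left[OF f] rep_scale[OF RX[OF i]])
    have "finite {n. ract n a (h i) \<noteq> 0}"
      using finite_ract_nonzero[of "h i" d a] d hX[OF i] ract_span_orbit by blast
    then show "finite {n. t n a i j \<noteq> 0}"
      by (rule finite_subset[rotated]) (auto simp: t_def functional.representation_zero)
    fix k assume k: "k < N"
    have "(\<Sum>j<N. t n a i j * t m b j k)
      = functional.representation A (\<Sum>j<N. fscale (t n a i j) (ract m b (h j))) (h k)"
      by (subst rep_sum) (simp_all add: RX t_def)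
    also have "(\<Sum>j<N. fscale (t n a i j) (ract m b (h j))) = ract m b (ract n a (h i))"
      unfolding expand[OF i, of n a] by (simp only: ract_sum ract_fscale)
    also have "\<dots> = (\<Sum>s\<le>n. fscale (of_nat (n choose s)) (ract (m + s) (prod (n - s) a b) (h i)))"
      by (rule ract_ract[OF f])
    also have "functional.representation A \<dots> (h k)
      = (\<Sum>s\<le>n. of_nat (n choose s) * t (m + s) (prod (n - s) a b) i k)"
      by (subst rep_sum) (simp_all add: RX[OF i] t_def)
    finally show "(\<Sum>j<N. t n a i j * t m b j k)
      = (\<Sum>s\<le>n. of_nat (n choose s) * t (m + s) (prod (n - s) a b) i k)" .
  qed
  moreover have "a = 0" if t0: "\<forall>n i j. i < N \<longrightarrow> j < N \<longrightarrow> t n a i j = 0" for a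
  proof -
    have "coeff (coord a j) n = 0" if j: "j \<in> B" for j n
    proof -
      have "ract n a f = 0" if "f \<in> functional.span A" for f
        using that
      proof (induction rule: functional.span_induct)
        case base
        show ?case
          by (rule functional.subspaceI; unfold mem_Collect_eq ract_zero ract_add_right ract_fscale) simp_all
      next
        case (step f)
        then obtain i where "i < N" "f = h i" using h by (auto simp: bij_betw_def N_def)
        then show ?case using expand[of i n a] t0 by simp
      qed
      moreover have "coord_fun j 0 \<in> functional.span A"
        unfolding span_A using j by (intro functional.span_base) (auto simp: orbit_def)
      \<comment> \<open>Evaluation at the identity recovers \<open>coord_fun j 0\<close> at a(n),
        which is (-1)^n n! times the desired coefficient.\<close>
      ultimately have "ract n a (coord_fun j 0) None = 0" by simp
      then show ?thesis by (simp add: coord_fun_def)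
    qed
    then have "coord a j = 0" if "j \<in> B" for j
      using that by (intro poly_eqI) simp
    then show "a = 0" using coord_sum[of a] by simp
  qed
  ultimately show ?thesis by blast
qed

end

theorem theorem2:
  fixes scale :: "'k::field_char_0 poly \<Rightarrow> 'c::ab_group_add \<Rightarrow> 'c"
    and prod :: "nat \<Rightarrow> 'c \<Rightarrow> 'c \<Rightarrow> 'c"
  assumes "associative_conformal_algebra scale prod"
    and "H_module.finitely_generated scale UNIV"
    and "H_module.torsion_free scale UNIV"
  shows "\<exists>(scaleM :: 'k poly \<Rightarrow> 'k poly poly \<Rightarrow> 'k poly poly) V act.
    conformal_representation scale prod scaleM V act \<and>
    H_module.free_finitely_generated scaleM V \<and>
    conformal_representation.faithful V act"
proof -
  interpret C: associative_conformal_algebra scale prod by fact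
  obtain B where "finite B" "C.independent B" "C.span B = UNIV"
    using C.torsion_free_imp_free[OF assms(2,3)] unfolding C.free_finitely_generated_def by blast
  then interpret based_conformal_algebra scale prod B
    by unfold_locales
  obtain N t where "conformal_matrices scale prod N t"
    and faithful: "\<And>a. (\<And>n i j. i < N \<Longrightarrow> j < N \<Longrightarrow> t n a i j = 0) \<Longrightarrow> a = 0"
    using faithful_matrices_exist by blast
  then interpret M: conformal_matrices scale prod N t by simp
  show ?thesis
    using M.conformal_representation_act M.free_V M.faithful_act[OF faithful] by blast
qed

end
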